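(* Let $V$ be a nonempty doubled word, $q\geq 2$ an integer, and $W_n\in[q]^n$ chosen uniformly at random. Then, as $n\to\infty$, $$\frac{1}{n}\ll\mathbb{E}(\delta(V,W_n))\ll\frac{\log n}{n}.$$
   Context: A word is doubled if every letter occurring in it occurs at least twice. $[q]=\{1,\dots,q\}$ and $[q]^n$ is the set of words of length $n$ over $[q]$. A word $U$ is an instance of $V$ (a $V$-instance) if $U=\phi(V)$ for some homomorphism $\phi$ of free monoids that is nonerasing (no letter is mapped to the empty word). For a word $W$ and $0\le i<j\le|W|$, $W[i,j]$ is the factor consisting of the $j-i$ consecutive letters of $W$ beginning with the $(i+1)$-th. The density of $V$ in $W$ is $$\delta(V,W)=\frac{|\{(i,j):0\le i<j\le|W|,\ W[i,j]\text{ is a }V\text{-instance}\}|}{\binom{|W|+1}{2}}.$$ $g(n)\ll h(n)$ means $g(n)=O(h(n))$ as $n\to\infty$; the implied constants may depend on $V$ and $q$. *)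

theory Defs
  imports "HOL-Probability.Probability" "HOL-Library.Landau_Symbols"
begin

text \<open>The free monoid over an alphabet, the type of its letters, is the type of lists with append.\<close>

definition doubled :: "'a list \<Rightarrow> bool" where
  "doubled V \<longleftrightarrow> (\<forall>x\<in>set V. 2 \<le> count_list V x)"

definition word_hom :: "('a list \<Rightarrow> 'b list) \<Rightarrow> bool" where
  "word_hom \<phi> \<longleftrightarrow> \<phi> [] = [] \<and> (\<forall>u v. \<phi> (u @ v) = \<phi> u @ \<phi> v)"

definition nonerasing :: "('a list \<Rightarrow> 'b list) \<Rightarrow> bool" where
  "nonerasing \<phi> \<longleftrightarrow> (\<forall>x. \<phi> [x] \<noteq> [])"

definition is_instance :: "'a list \<Rightarrow> 'b list \<Rightarrow> bool" where
  "is_instance V U \<longleftrightarrow> (\<exists>\<phi>. word_hom \<phi> \<and> nonerasing \<phi> \<and> U = \<phi> V)"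

definition factor :: "'a list \<Rightarrow> nat \<Rightarrow> nat \<Rightarrow> 'a list" where
  "factor W i j = take (j - i) (drop i W)"

definition word_density :: "'a list \<Rightarrow> 'b list \<Rightarrow> real" where
  "word_density V W =
     real (card {(i, j). i < j \<and> j \<le> length W \<and> is_instance V (factor W i j)})
       / real ((length W + 1) choose 2)"

definition words :: "nat \<Rightarrow> nat \<Rightarrow> nat list set" where
  "words q n = {w. set w \<subseteq> {1..q} \<and> length w = n}"

definition expected_density :: "'a list \<Rightarrow> nat \<Rightarrow> nat \<Rightarrow> real" where
  "expected_density V q n =
     measure_pmf.expectation (pmf_of_set (words q n)) (\<lambda>W. word_density V W)"

end

theory Submission
  imports Defs
begin

text \<open>The expected density has order exactly \<open>1 / n\<close>. By linearity of expectation, the expected number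
  of \<open>V\<close>-instances among the factors of a random word is a sum over starting positions. At a
  position followed by \<open>m\<close> letters, the expected number of instances starting there is the
  mass \<open>\<Sum> q\<^sup>-\<^sup>|\<^sup>U\<^sup>|\<close>, extended over the instances \<open>U\<close> with \<open>1 \<le> |U| \<le> m\<close>
  (\<open>expected_density_eq\<close>).

  This mass is at most 1, and bounded away from 0 once \<open>m \<ge> |V|\<close>. An instance is determined by the images of the
  letters of \<open>V\<close>, so the mass is at most a sum over all choices of these images, and that sum
  factorises over the letters. A letter \<open>x\<close> that occurs \<open>c\<close> times contributes
  \<open>\<Sum> q\<^sup>-\<^sup>c\<^sup>|\<^sup>w\<^sup>|\<close> over nonempty words \<open>w\<close>; since \<open>c \<ge> 2\<close> and there are \<open>q\<^sup>l\<close> words of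
  length \<open>l\<close>, this is at most \<open>\<Sum> q\<^sup>-\<^sup>l \<le> 1\<close> (\<open>instance_mass_le_1\<close>). In the other direction,
  a constant word of length \<open>|V|\<close> is an instance and contributes \<open>q\<^sup>-\<^sup>|\<^sup>V\<^sup>|\<close> as soon as it fits
  (\<open>instance_mass_ge\<close>).

  So the expected number of instances is at most \<open>n\<close> and, for large \<open>n\<close>, at least a
  constant multiple of \<open>n\<close>;
  division by the binomial coefficient \<open>n (n + 1) / 2\<close> gives the order \<open>1 / n\<close>, and
  \<open>1 / n\<close> is dominated by \<open>ln n / n\<close>.\<close>

section \<open>Words of bounded length\<close>

lemma finite_words [simp]: "finite (words q n)"
  unfolding words_def by (rule finite_lists_length_eq) simp

lemma card_words [simp]: "card (words q n) = q ^ n"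
  unfolding words_def using card_lists_length_eq[of "{1..q}" n] by simp

text \<open>Nonempty words only, since these are the possible images of a letter; the bound on the length
  keeps all sums finite.\<close>

definition short_words :: "nat \<Rightarrow> nat \<Rightarrow> nat list set" where
  "short_words q m = (\<Union>l\<in>{1..m}. words q l)"

lemma short_words_iff: "w \<in> short_words q m \<longleftrightarrow> set w \<subseteq> {1..q} \<and> w \<noteq> [] \<and> length w \<le> m"
  by (cases w) (auto simp: short_words_def words_def)

lemma finite_short_words [simp]: "finite (short_words q m)"
  by (simp add: short_words_def)

lemma sum_short_words: "sum f (short_words q m) = (\<Sum>l\<in>{1..m}. sum f (words q l))"
  unfolding short_words_def by (rule sum.UNION_disjoint) (simp, simp, force simp: words_def)

section \<open>The mass of the instances of a word\<close>

text \<open>Equivalently, the expected number of nonempty prefixes of a uniform random word of length \<open>m\<close>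
  that are \<open>V\<close>-instances.\<close>

definition instance_mass :: "'a list \<Rightarrow> nat \<Rightarrow> nat \<Rightarrow> real" where
  "instance_mass V q m = (\<Sum>U | U \<in> short_words q m \<and> is_instance V U. (1 / real q) ^ length U)"

lemma word_hom_eq_concat_map: "word_hom \<phi> \<Longrightarrow> \<phi> u = concat (map (\<lambda>x. \<phi> [x]) u)"
proof (induction u)
  case Nil
  then show ?case by (simp add: word_hom_def)
next
  case (Cons x u)
  from Cons.prems have "\<phi> ([x] @ u) = \<phi> [x] @ \<phi> u"
    unfolding word_hom_def by blast
  with Cons show ?case by simp
qed

text \<open>The exponent 2 is the least multiplicity of a letter in a doubled word. It beats the number
  \<open>q\<^sup>l\<close> of words of length \<open>l\<close>.\<close>

lemma sum_square_weights_le_1: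
  assumes "q \<ge> 2"
  shows "(\<Sum>w\<in>short_words q m. ((1 / real q) ^ length w)\<^sup>2) \<le> 1"
proof -
  have "(\<Sum>w\<in>short_words q m. ((1 / real q) ^ length w)\<^sup>2)
      = (\<Sum>l\<in>{1..m}. \<Sum>w\<in>words q l. ((1 / real q) ^ l)\<^sup>2)"
    unfolding sum_short_words by (intro sum.cong refl) (simp add: words_def)
  also have "\<dots> = (\<Sum>l\<in>{1..m}. (1 / real q) ^ l)"
    using assms by (intro sum.cong refl) (simp add: power2_eq_square field_simps)
  also have "\<dots> \<le> (\<Sum>l\<in>{1..m}. (1 / 2) ^ l)"
    using assms by (intro sum_mono power_mono) (auto simp: field_simps)
  also have "\<dots> = 1 - (1 / 2) ^ m"
    by (induction m) auto
  also have "\<dots> \<le> 1" by simp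
  finally show ?thesis .
qed

text \<open>An instance may arise from several choices of letter images; counting it once for each choice
  only increases the mass, and it makes the sum a product over the letters of \<open>V\<close>.\<close>

lemma instance_mass_le_1:
  assumes "doubled V" "q \<ge> 2"
  shows "instance_mass V q m \<le> 1"
proof -
  let ?F = "set V \<rightarrow>\<^sub>E short_words q m"
  let ?img = "\<lambda>f. concat (map f V)"
  let ?wt = "\<lambda>U. (1 / real q) ^ length U"
  have fin: "finite ?F"
    by (intro finite_PiE) auto
  have sub: "{U. U \<in> short_words q m \<and> is_instance V U} \<subseteq> ?img ` ?F"
  proof
    fix U assume "U \<in> {U. U \<in> short_words q m \<and> is_instance V U}"
    then obtain \<phi> where U: "U \<in> short_words q m" and hom: "word_hom \<phi>" "nonerasing \<phi>" "U = \<phi> V"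
      unfolding is_instance_def by blast
    define f where "f = restrict (\<lambda>x. \<phi> [x]) (set V)"
    have U_eq: "U = ?img f"
      using word_hom_eq_concat_map[OF hom(1), of V] hom(3)
      by (simp add: f_def cong: map_cong)
    have "f x \<in> short_words q m" if x: "x \<in> set V" for x
    proof -
      from x obtain V1 V2 where "V = V1 @ x # V2" by (auto dest: split_list)
      then have "U = ?img f" "?img f = concat (map f V1) @ f x @ concat (map f V2)"
        using U_eq by auto
      moreover have "f x \<noteq> []"
        using x hom(2) by (simp add: f_def nonerasing_def)
      ultimately show ?thesis
        using U by (auto simp: short_words_iff)
    qed
    then have "f \<in> ?F" by (auto simp: f_def)
    with U_eq show "U \<in> ?img ` ?F" by blast
  qed
  have wt: "?wt (?img f) \<le> (\<Prod>x\<in>set V. (?wt (f x))\<^sup>2)" for f :: "'a \<Rightarrow> nat list"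
  proof -
    have "length (?img f) = (\<Sum>x\<in>set V. count_list V x * length (f x))"
      by (simp add: length_concat o_def sum_list_map_eq_sum_count)
    then have "?wt (?img f) = (\<Prod>x\<in>set V. ?wt (f x) ^ count_list V x)"
      by (simp add: power_sum mult.commute flip: power_mult)
    also have "\<dots> \<le> (\<Prod>x\<in>set V. (?wt (f x))\<^sup>2)"
      using assms unfolding doubled_def
      by (intro prod_mono conjI power_decreasing power_le_one) auto
    finally show ?thesis .
  qed
  have "instance_mass V q m \<le> (\<Sum>U\<in>?img ` ?F. ?wt U)"
    unfolding instance_mass_def using fin sub by (intro sum_mono2) auto
  also have "\<dots> \<le> (\<Sum>f\<in>?F. ?wt (?img f))"
    using sum_image_le[OF fin, of ?wt ?img] by (simp add: o_def)
  also have "\<dots> \<le> (\<Sum>f\<in>?F. \<Prod>x\<in>set V. (?wt (f x))\<^sup>2)"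
    by (intro sum_mono wt)
  also have "\<dots> = (\<Prod>x\<in>set V. \<Sum>w\<in>short_words q m. (?wt w)\<^sup>2)"
    by (rule prod_sum_PiE[symmetric]) auto
  also have "\<dots> \<le> 1"
    using sum_square_weights_le_1[OF assms(2)] by (intro prod_le_1) (auto intro: sum_nonneg)
  finally show ?thesis .
qed

lemma instance_mass_nonneg: "instance_mass V q m \<ge> 0"
  unfolding instance_mass_def by (intro sum_nonneg) auto

lemma instance_mass_ge:
  assumes "V \<noteq> []" "q \<ge> 1" "length V \<le> m"
  shows "(1 / real q) ^ length V \<le> instance_mass V q m"
proof -
  let ?U = "replicate (length V) (1::nat)"
  have "word_hom (map (\<lambda>_::'a. 1::nat))" "nonerasing (map (\<lambda>_::'a. 1::nat))"
    by (auto simp: word_hom_def nonerasing_def)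
  moreover have "?U = map (\<lambda>_. 1) V"
    by (simp add: map_replicate_const)
  ultimately have "is_instance V ?U"
    unfolding is_instance_def by blast
  moreover have "?U \<in> short_words q m"
    using assms by (auto simp: short_words_iff)
  ultimately have "(\<Sum>U\<in>{?U}. (1 / real q) ^ length U) \<le> instance_mass V q m"
    unfolding instance_mass_def by (intro sum_mono2) auto
  then show ?thesis by simp
qed

section \<open>Expected number of instances in a random word\<close>

text \<open>Each factor of a uniform random word is again uniform: a word of length \<open>l\<close> can be completed to
  the left and to the right in \<open>q\<^sup>n\<^sup>-\<^sup>l\<close> ways.\<close>

lemma card_words_factor_eq:
  assumes "i + l \<le> n" "U \<in> words q l"
  shows "card {W \<in> words q n. factor W i (i + l) = U} = q ^ (n - l)"
proof -
  let ?g = "\<lambda>(a, b). a @ U @ b"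
  let ?P = "words q i \<times> words q (n - (i + l))"
  have "{W \<in> words q n. factor W i (i + l) = U} = ?g ` ?P"
  proof (intro equalityI subsetI)
    fix W assume W: "W \<in> {W \<in> words q n. factor W i (i + l) = U}"
    then have "W = take i W @ U @ drop l (drop i W)"
      by (metis (mono_tags, lifting) add_diff_cancel_left' append_take_drop_id factor_def mem_Collect_eq)
    moreover have "take i W \<in> words q i" "drop l (drop i W) \<in> words q (n - (i + l))"
      using W assms by (auto simp: words_def dest!: in_set_takeD in_set_dropD)
    ultimately show "W \<in> ?g ` ?P"
      by (intro image_eqI[of _ _ "(take i W, drop l (drop i W))"]) auto
  next
    fix W assume "W \<in> ?g ` ?P"
    then show "W \<in> {W \<in> words q n. factor W i (i + l) = U}"
      using assms by (force simp: words_def factor_def)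
  qed
  moreover have "inj_on ?g ?P"
    by (auto simp: inj_on_def words_def)
  ultimately have "card {W \<in> words q n. factor W i (i + l) = U} = q ^ i * q ^ (n - (i + l))"
    by (simp add: card_image card_cartesian_product)
  also have "\<dots> = q ^ (n - l)"
    using assms by (simp flip: power_add)
  finally show ?thesis .
qed

lemma card_words_factor_instance:
  assumes "i + l \<le> n"
  shows "card {W \<in> words q n. is_instance V (factor W i (i + l))}
       = card {U \<in> words q l. is_instance V U} * q ^ (n - l)"
proof -
  have factor_in: "factor W i (i + l) \<in> words q l" if "W \<in> words q n" for W
    using that assms by (auto simp: words_def factor_def dest!: in_set_takeD in_set_dropD)
  have "{W \<in> words q n. is_instance V (factor W i (i + l))}
      = (\<Union>U\<in>{U \<in> words q l. is_instance V U}. {W \<in> words q n. factor W i (i + l) = U})"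
    using factor_in by auto
  also have "card \<dots> = (\<Sum>U\<in>{U \<in> words q l. is_instance V U}.
      card {W \<in> words q n. factor W i (i + l) = U})"
    by (rule card_UN_disjoint) auto
  also have "\<dots> = card {U \<in> words q l. is_instance V U} * q ^ (n - l)"
    using assms by (simp add: card_words_factor_eq)
  finally show ?thesis .
qed

lemma card_instance_factors:
  "card {(i, j). i < j \<and> j \<le> length W \<and> is_instance V (factor W i j)}
     = (\<Sum>i<length W. \<Sum>l\<in>{1..length W - i}. of_bool (is_instance V (factor W i (i + l))))"
proof -
  let ?L = "\<lambda>i. {l \<in> {1..length W - i}. is_instance V (factor W i (i + l))}"
  have "bij_betw (\<lambda>(i, l). (i, i + l)) (SIGMA i:{..<length W}. ?L i)
      {(i, j). i < j \<and> j \<le> length W \<and> is_instance V (factor W i j)}"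
    by (rule bij_betwI[where g = "\<lambda>(i, j). (i, j - i)"]) auto
  then have "card {(i, j). i < j \<and> j \<le> length W \<and> is_instance V (factor W i j)}
      = card (SIGMA i:{..<length W}. ?L i)"
    by (simp add: bij_betw_same_card)
  also have "\<dots> = (\<Sum>i<length W. card (?L i))"
    by (rule card_SigmaI) auto
  finally show ?thesis
    by (simp add: sum.If_cases of_bool_def Int_def)
qed

lemma instance_mass_by_length:
  "instance_mass V q m
     = (\<Sum>l\<in>{1..m}. real (card {U \<in> words q l. is_instance V U}) * (1 / real q) ^ l)"
proof -
  have "instance_mass V q m
      = (\<Sum>U\<in>short_words q m. if is_instance V U then (1 / real q) ^ length U else 0)"
    unfolding instance_mass_def by (rule sum.inter_filter) simp
  also have "\<dots> = (\<Sum>l\<in>{1..m}. \<Sum>U\<in>words q l. if is_instance V U then (1 / real q) ^ l else 0)"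
    unfolding sum_short_words by (intro sum.cong refl) (simp add: words_def)
  also have "\<dots> = (\<Sum>l\<in>{1..m}. \<Sum>U | U \<in> words q l \<and> is_instance V U. (1 / real q) ^ l)"
    by (simp only: sum.inter_filter[OF finite_words])
  finally show ?thesis by simp
qed

lemma expected_density_eq:
  assumes "q \<ge> 1"
  shows "expected_density V q n = (\<Sum>i<n. instance_mass V q (n - i)) / real ((n + 1) choose 2)"
proof -
  have nonempty: "words q n \<noteq> {}"
    using assms card_words[of q n] by (metis card.empty not_one_le_zero power_eq_0_iff)
  have count: "(\<Sum>W\<in>words q n.
        real (card {(i, j). i < j \<and> j \<le> length W \<and> is_instance V (factor W i j)}))
      = (\<Sum>i<n. instance_mass V q (n - i)) * real q ^ n"
  proof -
    have "(\<Sum>W\<in>words q n.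
          real (card {(i, j). i < j \<and> j \<le> length W \<and> is_instance V (factor W i j)}))
        = (\<Sum>W\<in>words q n. \<Sum>i<n. \<Sum>l\<in>{1..n - i}. of_bool (is_instance V (factor W i (i + l))))"
    proof (intro sum.cong refl)
      fix W assume "W \<in> words q n"
      then have "n = length W" by (simp add: words_def)
      then show "real (card {(i, j). i < j \<and> j \<le> length W \<and> is_instance V (factor W i j)})
          = (\<Sum>i<n. \<Sum>l\<in>{1..n - i}. of_bool (is_instance V (factor W i (i + l))))"
        by (simp only: card_instance_factors of_nat_sum of_nat_of_bool)
    qed
    also have "\<dots> = (\<Sum>i<n. \<Sum>W\<in>words q n. \<Sum>l\<in>{1..n - i}.
        of_bool (is_instance V (factor W i (i + l))))"
      by (rule sum.swap)
    also have "\<dots> = (\<Sum>i<n. \<Sum>l\<in>{1..n - i}. \<Sum>W\<in>words q n.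
        of_bool (is_instance V (factor W i (i + l))))"
      by (intro sum.cong refl sum.swap)
    also have "\<dots> = (\<Sum>i<n. \<Sum>l\<in>{1..n - i}.
        real (card {W \<in> words q n. is_instance V (factor W i (i + l))}))"
      by (intro sum.cong refl) (simp add: Int_def)
    also have "\<dots> = (\<Sum>i<n. instance_mass V q (n - i) * real q ^ n)"
      unfolding instance_mass_by_length sum_distrib_right
    proof (intro sum.cong refl)
      fix i l assume "i \<in> {..<n}" "l \<in> {1..n - i}"
      then have il: "i + l \<le> n" by auto
      then have "real q ^ (n - l) = (1 / real q) ^ l * real q ^ n"
        using assms by (simp add: power_diff power_divide)
      with il show "real (card {W \<in> words q n. is_instance V (factor W i (i + l))})
          = real (card {U \<in> words q l. is_instance V U}) * (1 / real q) ^ l * real q ^ n"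
        by (simp add: card_words_factor_instance)
    qed
    finally show ?thesis by (simp add: sum_distrib_right)
  qed
  have "expected_density V q n = (\<Sum>W\<in>words q n. word_density V W) / real q ^ n"
    unfolding expected_density_def using nonempty by (simp add: integral_pmf_of_set)
  also have "(\<Sum>W\<in>words q n. word_density V W)
      = (\<Sum>W\<in>words q n. real (card {(i, j). i < j \<and> j \<le> length W \<and> is_instance V (factor W i j)}))
        / real ((n + 1) choose 2)"
    unfolding sum_divide_distrib
    by (intro sum.cong refl) (simp add: word_density_def words_def)
  finally show ?thesis
    unfolding count using assms by simp
qed

section \<open>Bounds on the expected density\<close>

lemma real_choose_two: "real ((n + 1) choose 2) = real n * (real n + 1) / 2"
proof -
  have "even ((n + 1) * n)" by simp
  then show ?thesis
    by (simp add: choose_two real_of_nat_div field_simps)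
qed

lemma expected_density_le:
  assumes "doubled V" "q \<ge> 2"
  shows "expected_density V q n \<le> 2 / (real n + 1)"
proof -
  have "(\<Sum>i<n. instance_mass V q (n - i)) \<le> (\<Sum>i<n. 1)"
    by (intro sum_mono instance_mass_le_1 assms)
  then have "expected_density V q n \<le> real n / real ((n + 1) choose 2)"
    using assms by (simp add: expected_density_eq divide_right_mono)
  also have "\<dots> \<le> 2 / (real n + 1)"
    unfolding real_choose_two by (simp add: divide_simps)
  finally show ?thesis .
qed

text \<open>If \<open>n\<close> is at least twice the length of \<open>V\<close>, then more than half of the starting positions
  leave room for an instance of length \<open>|V|\<close>.\<close>

lemma expected_density_ge:
  assumes "V \<noteq> []" "q \<ge> 1" "n \<ge> 2 * length V"
  shows "expected_density V q n \<ge> (1 / real q) ^ length V / real n"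
proof -
  let ?k = "length V" and ?c = "(1 / real q) ^ length V"
  have n: "n > 0" using assms by (cases V) auto
  have "(real n + 1) / 2 * ?c \<le> real (n + 1 - ?k) * ?c"
    using assms(3) by (intro mult_right_mono) auto
  also have "\<dots> = (\<Sum>i<n + 1 - ?k. ?c)"
    by simp
  also have "\<dots> \<le> (\<Sum>i<n + 1 - ?k. instance_mass V q (n - i))"
    using assms by (intro sum_mono instance_mass_ge) auto
  also have "\<dots> \<le> (\<Sum>i<n. instance_mass V q (n - i))"
    using assms(1) by (intro sum_mono2) (auto simp: instance_mass_nonneg neq_Nil_conv)
  finally have "(real n + 1) / 2 * ?c / real ((n + 1) choose 2) \<le> expected_density V q n"
    unfolding expected_density_eq[OF assms(2)] by (rule divide_right_mono) simp
  moreover have "(real n + 1) / 2 * ?c / real ((n + 1) choose 2) = ?c / real n"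
    unfolding real_choose_two using n by (simp add: divide_simps)
  ultimately show ?thesis by simp
qed

theorem corollary4p19:
  fixes V :: "'a list" and q :: nat
  assumes "V \<noteq> []" and "doubled V" and "q \<ge> 2"
  shows "(\<lambda>n::nat. 1 / real n) \<in> O(\<lambda>n. expected_density V q n) \<and>
         (\<lambda>n. expected_density V q n) \<in> O(\<lambda>n::nat. ln (real n) / real n)"
proof
  have "norm (1 / real n) \<le> real q ^ length V * norm (expected_density V q n)"
    if "n \<ge> 2 * length V" for n
  proof -
    have "1 / real n = real q ^ length V * ((1 / real q) ^ length V / real n)"
      using assms(3) by (simp add: power_divide)
    also have "\<dots> \<le> real q ^ length V * expected_density V q n"
      using expected_density_ge[of V q n] assms that by (intro mult_left_mono) auto
    also have "\<dots> \<le> real q ^ length V * norm (expected_density V q n)"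
      by (intro mult_left_mono) auto
    finally show ?thesis by simp
  qed
  then show "(\<lambda>n::nat. 1 / real n) \<in> O(\<lambda>n. expected_density V q n)"
    by (intro bigoI[where c = "real q ^ length V"] eventually_sequentiallyI[of "2 * length V"])
next
  have "norm (expected_density V q n) \<le> 2 * norm (ln (real n) / real n)" if n: "n \<ge> 3" for n
  proof -
    have "expected_density V q n \<ge> 0"
      using assms(3) by (simp add: expected_density_eq sum_nonneg instance_mass_nonneg)
    then have "norm (expected_density V q n) \<le> 2 / (real n + 1)"
      using expected_density_le[OF assms(2,3), of n] by simp
    also have "\<dots> \<le> 2 * (1 / real n)"
      using n by (simp add: field_simps)
    also have "\<dots> \<le> 2 * (ln (real n) / real n)"
    proof -
      have "exp 1 \<le> real n" using exp_le n by linarith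
      then have "1 \<le> ln (real n)" using n by (simp add: ln_ge_iff)
      then show ?thesis by (intro mult_left_mono divide_right_mono) auto
    qed
    also have "\<dots> \<le> 2 * norm (ln (real n) / real n)"
      unfolding real_norm_def by (intro mult_left_mono abs_ge_self) simp
    finally show ?thesis .
  qed
  then show "(\<lambda>n. expected_density V q n) \<in> O(\<lambda>n::nat. ln (real n) / real n)"
    by (intro bigoI[where c = 2] eventually_sequentiallyI[of 3])
qed

end
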